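(* Let $X$ be a compact metric space, let $N\ge 1$ be an integer, and let $f:X\to X$ be a transitive $N$-distal homeomorphism. Then $f$ has at most $N-1$ minimal proper subsystems; that is, there are at most $N-1$ minimal subsets $A\subsetneq X$.
   Context: Let $d$ be the metric of $X$. For $x\in X$, the proximal cell of $x$ is $P(x)=\{y\in X : \inf_{n\in\mathbb{Z}} d(f^n(x),f^n(y))=0\}$. The homeomorphism $f$ is $N$-distal if $P(x)$ has at most $N$ points for every $x\in X$. It is transitive if for any pair of non-empty open sets $U,V\subseteq X$ there is an integer $n\in\mathbb{Z}$ with $f^n(U)\cap V\neq\emptyset$. A subset $A\subseteq X$ is minimal if it is non-empty, closed, $f$-invariant ($f(A)=A$), and has no proper non-empty closed $f$-invariant subset. *)

theory Defs
  imports "HOL-Analysis.Analysis"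
begin

(* A space is a subset X of a metric_space type, with the subspace topology
   (openin/closedin (top_of_set X)); f matters only on X. *)

(* f^n for an integer n. The inverse is taken relative to X, so this is meaningful
   at points of X when f is a bijection of X onto itself. *)
definition int_iterate :: "'a set \<Rightarrow> ('a \<Rightarrow> 'a) \<Rightarrow> int \<Rightarrow> 'a \<Rightarrow> 'a" where
  "int_iterate X f n = (if 0 \<le> n then f ^^ nat n else inv_into X f ^^ nat (- n))"

(* The real-valued INF below is a genuine infimum: the index set is all of int and
   distances are bounded below by 0. *)
definition proximal_cell :: "'a::metric_space set \<Rightarrow> ('a \<Rightarrow> 'a) \<Rightarrow> 'a \<Rightarrow> 'a set" where
  "proximal_cell X f x =
     {y \<in> X. (INF n::int. dist (int_iterate X f n x) (int_iterate X f n y)) = 0}"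

definition N_distal :: "'a::metric_space set \<Rightarrow> ('a \<Rightarrow> 'a) \<Rightarrow> nat \<Rightarrow> bool" where
  "N_distal X f N \<longleftrightarrow>
     (\<forall>x\<in>X. finite (proximal_cell X f x) \<and> card (proximal_cell X f x) \<le> N)"

definition transitive_on :: "'a::metric_space set \<Rightarrow> ('a \<Rightarrow> 'a) \<Rightarrow> bool" where
  "transitive_on X f \<longleftrightarrow>
     (\<forall>U V. openin (top_of_set X) U \<and> U \<noteq> {} \<and> openin (top_of_set X) V \<and> V \<noteq> {} \<longrightarrow>
        (\<exists>n::int. int_iterate X f n ` U \<inter> V \<noteq> {}))"

definition minimal_subset :: "'a::metric_space set \<Rightarrow> ('a \<Rightarrow> 'a) \<Rightarrow> 'a set \<Rightarrow> bool" where
  "minimal_subset X f A \<longleftrightarrow>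
     A \<noteq> {} \<and> closedin (top_of_set X) A \<and> f ` A = A \<and>
     \<not> (\<exists>B. B \<subset> A \<and> B \<noteq> {} \<and> closedin (top_of_set X) B \<and> f ` B = B)"

end

(* A point x with dense orbit exists by Baire category. By the Auslander-Ellis theorem, every
   minimal proper A contains a point proximal to x: the maps p with each pair (p a, p b) in the
   orbit closure of (a, b) form a compact semigroup, those with p x in A form a compact
   subsemigroup, and an idempotent u of the latter satisfies u (u x) = u x, so that x and u x
   are proximal. Distinct minimal sets are disjoint, and none of the proper ones contains x, so
   together with x these points give one more member of the proximal cell of x than there are
   minimal proper sets. *)

theory Submission
  imports Defs
begin

section \<open>Idempotents in compact semigroups\<close>

text \<open>A product of Hausdorff spaces is Hausdorff, and compact sets are closed there. This
  supplies the hypothesis \<open>closed\<close> of \<open>ellis_numakura\<close> for semigroups of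
  maps.\<close>

lemma compact_imp_closed_fun:
  fixes S :: "('a \<Rightarrow> 'b::t2_space) set"
  assumes "compact S"
  shows "closed S"
proof -
  have "Hausdorff_space (euclidean :: 'b topology)"
    unfolding Hausdorff_space_def disjnt_def by (simp add: separation_t2)
  then have "Hausdorff_space (product_topology (\<lambda>_::'a. euclidean::'b topology) UNIV)"
    by (simp add: Hausdorff_space_product_topology)
  then have "Hausdorff_space (euclidean :: ('a \<Rightarrow> 'b) topology)"
    by (simp add: euclidean_product_topology)
  then show ?thesis
    using assms compactin_imp_closedin[of euclidean S] by simp
qed

text \<open>A nonempty finite part of a chain has a least member, so its intersection is nonempty;
  the finite intersection property inside one compact member does the rest. The assumption
  \<open>closed\<close> stands in for the Hausdorff axiom.\<close>

lemma compact_chain_Inter_nonempty: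
  fixes \<C> :: "'b::topological_space set set"
  assumes closed: "\<And>K :: 'b set. compact K \<Longrightarrow> closed K"
    and "\<C> \<noteq> {}"
    and cpt: "\<And>T. T \<in> \<C> \<Longrightarrow> compact T \<and> T \<noteq> {}"
    and chain: "\<And>S T. S \<in> \<C> \<Longrightarrow> T \<in> \<C> \<Longrightarrow> S \<subseteq> T \<or> T \<subseteq> S"
  shows "compact (\<Inter>\<C>) \<and> \<Inter>\<C> \<noteq> {}"
proof -
  obtain T0 where T0: "T0 \<in> \<C>" using assms(2) by blast
  have least: "\<F> = {} \<or> (\<exists>T\<in>\<F>. T \<subseteq> \<Inter>\<F>)" if "finite \<F>" "\<F> \<subseteq> \<C>" for \<F>
    using that
  proof (induction rule: finite_induct)
    case (insert S \<F>)
    then consider "\<F> = {}" | T where "T \<in> \<F>" "T \<subseteq> \<Inter>\<F>" by blast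
    then show ?case
    proof cases
      case 2
      then show ?thesis using chain[of S T] insert.prems by auto
    qed auto
  qed simp
  have "T0 \<inter> \<Inter>\<C> \<noteq> {}"
  proof (rule compact_imp_fip)
    show "compact T0" using cpt T0 by blast
    show "closed T" if "T \<in> \<C>" for T using that cpt closed by blast
    fix \<F> assume "finite \<F>" "\<F> \<subseteq> \<C>"
    then obtain T where T: "T \<in> insert T0 \<F>" "T \<subseteq> \<Inter>(insert T0 \<F>)"
      using least[of "insert T0 \<F>"] T0 by blast
    have "T \<noteq> {}" using T(1) cpt T0 \<open>\<F> \<subseteq> \<C>\<close> by blast
    moreover have "T \<subseteq> T0 \<inter> \<Inter>\<F>" using T(2) by simp
    ultimately show "T0 \<inter> \<Inter>\<F> \<noteq> {}" by (metis subset_empty)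
  qed
  moreover have "compact (T0 \<inter> \<Inter>\<C>)"
    using cpt T0 by (intro compact_Int_closed closed_Inter) (auto intro: closed)
  moreover have "T0 \<inter> \<Inter>\<C> = \<Inter>\<C>" using T0 by blast
  ultimately show ?thesis by simp
qed

text \<open>Zorn's lemma gives a minimal compact subsemigroup \<open>T\<close>. For \<open>u\<close>
  in \<open>T\<close>, right translation by \<open>u\<close> maps \<open>T\<close> onto a compact
  subsemigroup of \<open>T\<close>, hence onto \<open>T\<close>, so some \<open>v\<close> in
  \<open>T\<close> satisfies \<open>v \<star> u = u\<close>. The left stabiliser of \<open>u\<close>
  in \<open>T\<close> is therefore a nonempty compact subsemigroup, so it equals \<open>T\<close>
  and contains \<open>u\<close>.\<close>

theorem ellis_numakura:
  fixes S :: "'b::topological_space set" and m :: "'b \<Rightarrow> 'b \<Rightarrow> 'b" (infixl "\<star>" 70)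
  assumes closed: "\<And>K :: 'b set. compact K \<Longrightarrow> closed K"
    and "compact S" "S \<noteq> {}"
    and "\<And>p q. p \<in> S \<Longrightarrow> q \<in> S \<Longrightarrow> p \<star> q \<in> S"
    and assoc: "\<And>p q r. p \<in> S \<Longrightarrow> q \<in> S \<Longrightarrow> r \<in> S \<Longrightarrow> p \<star> q \<star> r = p \<star> (q \<star> r)"
    and cont: "\<And>q. q \<in> S \<Longrightarrow> continuous_on S (\<lambda>p. p \<star> q)"
  shows "\<exists>u\<in>S. u \<star> u = u"
proof -
  define \<A> where
    "\<A> = {T. T \<subseteq> S \<and> compact T \<and> T \<noteq> {} \<and> (\<forall>p\<in>T. \<forall>q\<in>T. p \<star> q \<in> T)}"
  have "\<exists>T\<in>\<A>. \<forall>U\<in>\<A>. U \<subseteq> T \<longrightarrow> U = T"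
  \<comment> \<open>The order is reverse inclusion: a maximal element is minimal for inclusion, and
    a nonempty chain is bounded by its intersection.\<close>
  proof (rule predicate_Zorn)
    show "partial_order_on \<A> (relation_of (\<lambda>A B. B \<subseteq> A) \<A>)"
      by (auto simp: partial_order_on_def preorder_on_def refl_on_def trans_def antisym_def
          relation_of_def)
    fix \<C> assume \<C>: "\<C> \<in> Chains (relation_of (\<lambda>A B. B \<subseteq> A) \<A>)"
    then have sub: "\<C> \<subseteq> \<A>" and chain: "\<And>S T. S \<in> \<C> \<Longrightarrow> T \<in> \<C> \<Longrightarrow> S \<subseteq> T \<or> T \<subseteq> S"
      by (auto simp: Chains_def relation_of_def)
    show "\<exists>U\<in>\<A>. \<forall>T\<in>\<C>. U \<subseteq> T"
    proof (cases "\<C> = {}")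
      case True
      then show ?thesis using assms by (auto simp: \<A>_def)
    next
      case False
      then have "compact (\<Inter>\<C>) \<and> \<Inter>\<C> \<noteq> {}"
        using False sub chain by (intro compact_chain_Inter_nonempty closed) (auto simp: \<A>_def)
      moreover have "\<Inter>\<C> \<subseteq> S" using False sub by (intro Inter_subset) (auto simp: \<A>_def)
      moreover have "p \<star> q \<in> \<Inter>\<C>" if "p \<in> \<Inter>\<C>" "q \<in> \<Inter>\<C>" for p q
        using that sub by (auto simp: \<A>_def)
      ultimately have "\<Inter>\<C> \<in> \<A>" unfolding \<A>_def by blast
      then show ?thesis by blast
    qed
  qed
  then obtain T where T: "T \<in> \<A>" and min: "\<And>U. U \<in> \<A> \<Longrightarrow> U \<subseteq> T \<Longrightarrow> U = T" by blast
  have TS: "T \<subseteq> S" and cT: "compact T" and mT: "\<And>p q. p \<in> T \<Longrightarrow> q \<in> T \<Longrightarrow> p \<star> q \<in> T"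
    using T by (auto simp: \<A>_def)
  obtain u where u: "u \<in> T" using T by (auto simp: \<A>_def)
  have cu: "continuous_on T (\<lambda>p. p \<star> u)"
    using cont u TS continuous_on_subset by blast
  have "(\<lambda>p. p \<star> u) ` T \<in> \<A>"
  proof -
    have "p \<star> u \<star> (q \<star> u) = (p \<star> u \<star> q) \<star> u" if "p \<in> T" "q \<in> T" for p q
      using assoc[of "p \<star> u" q u] that u mT TS by (simp add: subset_iff)
    then show ?thesis
      using compact_continuous_image[OF cu cT] u mT TS by (fastforce simp: \<A>_def)
  qed
  then have "(\<lambda>p. p \<star> u) ` T = T" using min mT u by blast
  then obtain v where v: "v \<in> T" "v \<star> u = u" using u by (metis imageE)
  define W where "W = T \<inter> (\<lambda>p. p \<star> u) -` {u}"
  have "W \<in> \<A>"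
  proof -
    \<comment> \<open>The singleton is compact, hence closed, which makes the stabiliser
      \<open>W\<close> a closed subset of \<open>T\<close>.\<close>
    have "closed T" "closed {u}" using cT by (auto intro: closed)
    then have "closed ((\<lambda>p. p \<star> u) -` {u} \<inter> T)"
      using cu continuous_on_closed_vimage by blast
    then have "closed W" by (simp add: W_def Int_commute)
    then have "compact W"
      using cT by (metis W_def Int_absorb1 compact_Int_closed inf_le1)
    moreover have "p \<star> q \<in> W" if "p \<in> W" "q \<in> W" for p q
      using that u mT TS assoc[of p q u] by (auto simp: W_def subset_iff)
    ultimately show ?thesis using v TS by (auto simp: \<A>_def W_def)
  qed
  then have "W = T" using min by (simp add: W_def)
  then show ?thesis using u TS by (auto simp: W_def)
qed

section \<open>Integer iterates of a homeomorphism\<close>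

text \<open>\<open>int_iterate\<close> is built on \<open>inv_into X f\<close>, so the given inverse
  is exchanged for it; by injectivity the two agree on \<open>X\<close>.\<close>

lemma homeomorphism_inv_into:
  assumes "homeomorphism X X f g"
  shows "homeomorphism X X f (inv_into X f)"
proof -
  have inj: "inj_on f X" using assms by (metis homeomorphism_apply1 inj_onI)
  have "inv_into X f y = g y" if "y \<in> X" for y
    using that assms inj by (metis homeomorphism_def image_eqI inv_into_f_f)
  then show ?thesis
    using assms by (auto intro: homeomorphism_cong)
qed

lemma int_iterate_0 [simp]: "int_iterate X f 0 y = y"
  by (simp add: int_iterate_def)

lemma int_iterate_invariant:
  assumes "f ` X \<subseteq> X" "inv_into X f ` X \<subseteq> X" "y \<in> X"
  shows "int_iterate X f n y \<in> X"
proof -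
  have "(k ^^ i) y \<in> X" if "k ` X \<subseteq> X" for i and k :: "'a \<Rightarrow> 'a"
    using that assms(3) by (induction i) auto
  then show ?thesis using assms by (simp add: int_iterate_def)
qed

lemma map_prod_int_iterate_invariant:
  assumes "map_prod f f ` C \<subseteq> C" "map_prod (inv_into X f) (inv_into X f) ` C \<subseteq> C" "(a, b) \<in> C"
  shows "(int_iterate X f n a, int_iterate X f n b) \<in> C"
proof -
  have "((k ^^ i) a, (k ^^ i) b) \<in> C" if "map_prod k k ` C \<subseteq> C" for i and k :: "'a \<Rightarrow> 'a"
    using that assms(3) by (induction i) auto
  then show ?thesis using assms by (simp add: int_iterate_def)
qed

lemma continuous_on_int_iterate:
  assumes "continuous_on X f" "f ` X \<subseteq> X"
    "continuous_on X (inv_into X f)" "inv_into X f ` X \<subseteq> X"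
  shows "continuous_on X (int_iterate X f n)"
proof -
  have "continuous_on X (k ^^ i) \<and> (k ^^ i) ` X \<subseteq> X"
    if "continuous_on X k" "k ` X \<subseteq> X" for i and k :: "'a \<Rightarrow> 'a"
  proof (induction i)
    case (Suc i)
    then have "continuous_on X (k \<circ> (k ^^ i))"
      using that continuous_on_subset by (intro continuous_on_compose) blast+
    then show ?case using Suc that by auto
  qed auto
  then show ?thesis using assms by (simp add: int_iterate_def)
qed

lemma int_iterate_succ:
  assumes "homeomorphism X X f (inv_into X f)" "y \<in> X"
  shows "int_iterate X f (n + 1) y = f (int_iterate X f n y)"
proof (cases "0 \<le> n")
  case True
  then have "nat (n + 1) = Suc (nat n)" by simp
  then show ?thesis using True by (simp add: int_iterate_def)
next
  case False
  \<comment> \<open>For \<open>n = -1\<close> the iterate \<open>n + 1 = 0\<close> falls under the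
    nonnegative branch of \<open>int_iterate\<close>; both branches give the identity there.\<close>
  then have "nat (- n) = Suc (nat (- (n + 1)))" by simp
  then have *: "int_iterate X f n y = inv_into X f (int_iterate X f (n + 1) y)"
    using False by (auto simp: int_iterate_def)
  have "int_iterate X f (n + 1) y \<in> X"
    using assms by (intro int_iterate_invariant) (auto simp: homeomorphism_def)
  then show ?thesis unfolding * using assms by (simp add: homeomorphism_apply2)
qed

lemma int_iterate_pred:
  assumes "homeomorphism X X f (inv_into X f)" "y \<in> X"
  shows "int_iterate X f (n - 1) y = inv_into X f (int_iterate X f n y)"
proof -
  have "int_iterate X f (n - 1) y \<in> X"
    using assms by (intro int_iterate_invariant) (auto simp: homeomorphism_def)
  then show ?thesis
    using int_iterate_succ[OF assms, of "n - 1"] assms by (simp add: homeomorphism_apply1)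
qed

text \<open>The map and its inverse shift the orbit of the pair by one step, and continuity passes
  invariance to the closure. Hence \<open>C\<close> is one of the sets against which
  \<open>pair_preserving_maps\<close> tests.\<close>

lemma orbit_pair_closure_invariant:
  assumes X: "closed X" and h: "homeomorphism X X f (inv_into X f)" and xy: "x \<in> X" "y \<in> X"
  defines "C \<equiv> closure (range (\<lambda>n. (int_iterate X f n x, int_iterate X f n y)))"
  shows "C \<subseteq> X \<times> X" "map_prod f f ` C \<subseteq> C"
    "map_prod (inv_into X f) (inv_into X f) ` C \<subseteq> C"
proof -
  let ?R = "range (\<lambda>n. (int_iterate X f n x, int_iterate X f n y))"
  have R: "?R \<subseteq> X \<times> X"
    using h xy by (auto intro!: int_iterate_invariant simp: homeomorphism_def)
  then show CX: "C \<subseteq> X \<times> X"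
    unfolding C_def using X by (simp add: closed_Times closure_minimal)
  have *: "map_prod k k ` C \<subseteq> C" if "continuous_on X k" "map_prod k k ` ?R \<subseteq> ?R" for k
  proof -
    have "continuous_on C (\<lambda>z. (k (fst z), k (snd z)))"
      using CX that(1)
      by (intro continuous_on_Pair continuous_on_compose2[OF that(1)] continuous_intros) auto
    then have "continuous_on C (map_prod k k)"
      by (simp add: map_prod_def case_prod_beta)
    moreover have "map_prod k k ` ?R \<subseteq> C"
      unfolding C_def using that(2) closure_subset by blast
    ultimately show ?thesis
      unfolding C_def by (intro image_closure_subset) auto
  qed
  have shift: "map_prod k k ` ?R \<subseteq> ?R"
    if "\<And>n. k (int_iterate X f n x) = int_iterate X f (n + i) x"
      "\<And>n. k (int_iterate X f n y) = int_iterate X f (n + i) y" for k i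
  proof (rule image_subsetI)
    fix z assume "z \<in> ?R"
    then obtain n where "z = (int_iterate X f n x, int_iterate X f n y)" by (rule rangeE)
    then have "map_prod k k z = (int_iterate X f (n + i) x, int_iterate X f (n + i) y)"
      by (simp only: map_prod_simp that)
    then show "map_prod k k z \<in> ?R" by (rule range_eqI)
  qed
  have "map_prod f f ` ?R \<subseteq> ?R"
    by (rule shift[of f 1]) (simp_all only: int_iterate_succ[OF h] xy)
  moreover have "map_prod (inv_into X f) (inv_into X f) ` ?R \<subseteq> ?R"
    by (rule shift[of _ "-1"])
       (simp_all only: add_uminus_conv_diff int_iterate_pred[OF h] xy)
  moreover have "continuous_on X f" "continuous_on X (inv_into X f)"
    using h by (simp_all add: homeomorphism_def)
  ultimately show "map_prod f f ` C \<subseteq> C"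
    "map_prod (inv_into X f) (inv_into X f) ` C \<subseteq> C"
    using * by blast+
qed

section \<open>Proximal points in closed invariant sets\<close>

text \<open>This contains the Ellis semigroup (the closure of the iterates) and serves the same
  purpose, but closure under composition is immediate. Elements are the identity off \<open>X\<close>,
  which makes Tychonoff's theorem applicable to total functions.\<close>

definition pair_preserving_maps :: "'a::metric_space set \<Rightarrow> ('a \<Rightarrow> 'a) \<Rightarrow> ('a \<Rightarrow> 'a) set" where
  "pair_preserving_maps X f = {p. (\<forall>a. a \<notin> X \<longrightarrow> p a = a) \<and>
     (\<forall>C. C \<subseteq> X \<times> X \<and> closed C \<and> map_prod f f ` C \<subseteq> C \<and>
        map_prod (inv_into X f) (inv_into X f) ` C \<subseteq> C \<longrightarrow> map_prod p p ` C \<subseteq> C)}"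

lemma pair_preserving_mapsD:
  assumes "p \<in> pair_preserving_maps X f" "C \<subseteq> X \<times> X" "closed C" "map_prod f f ` C \<subseteq> C"
    "map_prod (inv_into X f) (inv_into X f) ` C \<subseteq> C" "(a, b) \<in> C"
  shows "(p a, p b) \<in> C"
  using assms unfolding pair_preserving_maps_def by blast

lemma pair_preserving_maps_comp:
  assumes "p \<in> pair_preserving_maps X f" "q \<in> pair_preserving_maps X f"
  shows "p \<circ> q \<in> pair_preserving_maps X f"
proof -
  have "map_prod (p \<circ> q) (p \<circ> q) ` C \<subseteq> C"
    if "map_prod p p ` C \<subseteq> C" "map_prod q q ` C \<subseteq> C" for C
    unfolding map_prod.comp[symmetric] using that by (auto simp del: map_prod.comp)
  then show ?thesis using assms unfolding pair_preserving_maps_def by simp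
qed

text \<open>The square \<open>A \<times> A\<close> is an admissible test set, so control of pairs
  includes control of single points.\<close>

lemma pair_preserving_maps_invariant:
  assumes "p \<in> pair_preserving_maps X f" "A \<subseteq> X" "closed A" "f ` A \<subseteq> A"
    "inv_into X f ` A \<subseteq> A" "a \<in> A"
  shows "p a \<in> A"
proof -
  have "(p a, p a) \<in> A \<times> A"
    using assms by (intro pair_preserving_mapsD[OF assms(1)]) (auto simp: closed_Times)
  then show ?thesis by simp
qed

text \<open>In the topology of pointwise convergence each defining condition involves at most two
  coordinates, so the set is an intersection of preimages of closed sets under evaluations.\<close>

lemma closed_pair_preserving_maps: "closed (pair_preserving_maps X f)"
proof -
  have [simp]: "closed {p :: 'a \<Rightarrow> 'a. p a = a}" for a
    by (intro closed_Collect_eq continuous_intros) auto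
  have [simp]: "closed {p :: 'a \<Rightarrow> 'a. (p a, p b) \<in> C}" if "closed C" for a b C
    using closed_vimage[OF that, of "\<lambda>p. (p a, p b)"]
    by (simp add: vimage_def continuous_on_Pair)
  have "pair_preserving_maps X f = (\<Inter>a\<in>{a. a \<notin> X}. {p. p a = a}) \<inter>
    (\<Inter>C\<in>{C. C \<subseteq> X \<times> X \<and> closed C \<and> map_prod f f ` C \<subseteq> C \<and>
        map_prod (inv_into X f) (inv_into X f) ` C \<subseteq> C}. \<Inter>(a, b)\<in>C. {p. (p a, p b) \<in> C})"
  proof -
    have "map_prod p p ` C \<subseteq> C \<longleftrightarrow> (\<forall>(a, b)\<in>C. (p a, p b) \<in> C)" for p :: "'a \<Rightarrow> 'a" and C
      by (simp add: image_subset_iff map_prod_def split_def)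
    then show ?thesis
      unfolding pair_preserving_maps_def set_eq_iff by (simp add: split_def)
  qed
  then show ?thesis by (auto intro!: closed_Int closed_INT)
qed

lemma compact_pair_preserving_maps:
  assumes "compact X" "f ` X \<subseteq> X" "inv_into X f ` X \<subseteq> X"
  shows "compact (pair_preserving_maps X f)"
proof -
  \<comment> \<open>Tychonoff: the maps lie in a product of copies of \<open>X\<close>, at points of
    \<open>X\<close>, and of singletons elsewhere.\<close>
  define K where "K = PiE UNIV (\<lambda>a. if a \<in> X then X else {a})"
  have "compactin (product_topology (\<lambda>_. euclidean) UNIV) K"
    unfolding K_def compactin_PiE using assms(1) by auto
  then have "compact K" by (simp add: euclidean_product_topology)
  moreover have "pair_preserving_maps X f \<subseteq> K"
  proof
    fix p assume p: "p \<in> pair_preserving_maps X f"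
    have "p a \<in> X" if "a \<in> X" for a
      using pair_preserving_maps_invariant[OF p, of X a] assms that
      by (simp add: compact_imp_closed)
    then show "p \<in> K" using p by (simp add: K_def PiE_iff pair_preserving_maps_def)
  qed
  ultimately show ?thesis
    using compact_Int_closed[OF _ closed_pair_preserving_maps] by (metis inf.absorb2)
qed

text \<open>This makes the semigroup large enough: its values at \<open>x\<close> cover the orbit of
  \<open>x\<close>, and by compactness the orbit closure.\<close>

lemma int_iterate_pair_preserving:
  "(\<lambda>a. if a \<in> X then int_iterate X f n a else a) \<in> pair_preserving_maps X f"
proof -
  have "map_prod p p ` C \<subseteq> C"
    if "C \<subseteq> X \<times> X" "map_prod f f ` C \<subseteq> C" "map_prod (inv_into X f) (inv_into X f) ` C \<subseteq> C"
      and p: "p = (\<lambda>a. if a \<in> X then int_iterate X f n a else a)" for p C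
  proof -
    have "(p a, p b) \<in> C" if "(a, b) \<in> C" for a b
      using that \<open>C \<subseteq> X \<times> X\<close> p map_prod_int_iterate_invariant[of f C X a b n]
        \<open>map_prod f f ` C \<subseteq> C\<close> \<open>map_prod (inv_into X f) (inv_into X f) ` C \<subseteq> C\<close> by auto
    then show ?thesis by auto
  qed
  then show ?thesis unfolding pair_preserving_maps_def by simp
qed

lemma proximal_cellI:
  assumes "y \<in> X" "\<And>e. e > 0 \<Longrightarrow> \<exists>n. dist (int_iterate X f n x) (int_iterate X f n y) < e"
  shows "y \<in> proximal_cell X f x"
proof -
  let ?d = "\<lambda>n. dist (int_iterate X f n x) (int_iterate X f n y)"
  have "bdd_below (range ?d)" by (meson bdd_belowI2 zero_le_dist)
  then have "(INF n. ?d n) < e" if "e > 0" for e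
    using assms(2)[OF that] cINF_lower[of ?d UNIV] by (meson UNIV_I le_less_trans)
  moreover have "0 \<le> (INF n. ?d n)" by (rule cINF_greatest) auto
  ultimately have "(INF n. ?d n) = 0" by (meson dense_ge order_antisym less_imp_le)
  then show ?thesis using assms(1) by (simp add: proximal_cell_def)
qed

theorem auslander_ellis:
  assumes X: "compact X" and h: "homeomorphism X X f (inv_into X f)" and x: "x \<in> X"
    and A: "A \<noteq> {}" "A \<subseteq> X" "closed A" "f ` A \<subseteq> A" "inv_into X f ` A \<subseteq> A"
    and orbit: "A \<subseteq> closure (range (\<lambda>n. int_iterate X f n x))"
  shows "\<exists>y\<in>A. y \<in> proximal_cell X f x"
proof -
  define E where "E = pair_preserving_maps X f"
  define L where "L = E \<inter> (\<lambda>p. p x) -` A"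
  have cE: "compact E"
    unfolding E_def using X h by (intro compact_pair_preserving_maps) (auto simp: homeomorphism_def)
  have "\<exists>u\<in>L. u \<circ> u = u"
  proof (rule ellis_numakura[where m = "(\<circ>)"])
    show "closed K" if "compact K" for K :: "('a \<Rightarrow> 'a) set"
      using that by (rule compact_imp_closed_fun)
    show "compact L"
      unfolding L_def using cE A(3) by (intro compact_Int_closed closed_vimage) auto
    \<comment> \<open>Evaluation at \<open>x\<close> has a compact, hence closed, image containing
      the orbit of \<open>x\<close>. It therefore contains \<open>A\<close>, so some map in
      \<open>E\<close> sends \<open>x\<close> into \<open>A\<close>.\<close>
    have "compact ((\<lambda>p. p x) ` E)"
      using cE
      by (intro compact_continuous_image continuous_on_subset[OF continuous_on_product_coordinates])
        auto
    moreover have "range (\<lambda>n. int_iterate X f n x) \<subseteq> (\<lambda>p. p x) ` E"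
    proof clarify
      fix n
      show "int_iterate X f n x \<in> (\<lambda>p. p x) ` E"
        using int_iterate_pair_preserving[of X f n] x unfolding E_def
        by (intro image_eqI) auto
    qed
    ultimately have "A \<subseteq> (\<lambda>p. p x) ` E"
      using orbit by (meson closure_minimal compact_imp_closed order_trans)
    then show "L \<noteq> {}" using A(1) by (auto simp: L_def)
    show "p \<circ> q \<in> L" if "p \<in> L" "q \<in> L" for p q
      using that A pair_preserving_maps_comp[of p X f q]
        pair_preserving_maps_invariant[of p X f A "q x"]
      by (auto simp: L_def E_def)
    \<comment> \<open>The value of \<open>p \<circ> q\<close> at \<open>a\<close> is the coordinate
      of \<open>p\<close> at \<open>q a\<close>; \<open>q\<close> itself may be
      discontinuous.\<close>
    show "continuous_on L (\<lambda>p. p \<circ> q)" for q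
      unfolding o_def
      by (intro continuous_on_coordinatewise_then_product
          continuous_on_subset[OF continuous_on_product_coordinates]) auto
  qed (auto simp: o_assoc)
  then obtain u where u: "u \<in> E" "u x \<in> A" "u (u x) = u x"
    by (metis L_def IntD1 IntD2 comp_apply vimageD)
  define y where "y = u x"
  have y: "y \<in> X" "y \<in> A" using u A(2) by (auto simp: y_def)
  define C where "C = closure (range (\<lambda>n. (int_iterate X f n x, int_iterate X f n y)))"
  have "(x, y) \<in> range (\<lambda>n. (int_iterate X f n x, int_iterate X f n y))"
    by (auto intro!: image_eqI[of _ _ 0])
  then have xy: "(x, y) \<in> C" unfolding C_def by (rule closure_subset[THEN subsetD])
  note C = orbit_pair_closure_invariant[OF compact_imp_closed[OF X] h x y(1), folded C_def]
  have "closed C" by (simp add: C_def)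
  \<comment> \<open>Applying \<open>u\<close> to the pair \<open>(x, y)\<close> collapses it to
    \<open>(y, y)\<close> by idempotence. So some iterate brings \<open>x\<close> and
    \<open>y\<close> close to the same point \<open>y\<close> simultaneously.\<close>
  then have "(u x, u y) \<in> C"
    by (rule pair_preserving_mapsD[OF u(1)[unfolded E_def] C(1) _ C(2,3) xy])
  then have yy: "(y, y) \<in> C" using u by (simp add: y_def)
  have "y \<in> proximal_cell X f x"
  proof (rule proximal_cellI[OF y(1)])
    fix e :: real assume "e > 0"
    then obtain n where n: "dist (int_iterate X f n x, int_iterate X f n y) (y, y) < e / 2"
      using yy unfolding C_def closure_approachable by (auto dest!: spec[of _ "e / 2"])
    have "dist (int_iterate X f n x) y < e / 2" "dist (int_iterate X f n y) y < e / 2"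
      using n dist_fst_le[of "(int_iterate X f n x, int_iterate X f n y)" "(y, y)"]
        dist_snd_le[of "(int_iterate X f n x, int_iterate X f n y)" "(y, y)"] by auto
    then show "\<exists>n. dist (int_iterate X f n x) (int_iterate X f n y) < e"
      by (meson dist_triangle_half_l)
  qed
  then show ?thesis using y by blast
qed

section \<open>Transitivity and minimal sets\<close>

text \<open>Total boundedness provides countably many balls of arbitrarily small radius covering
  \<open>X\<close>. The points whose orbit meets a given ball form an open set, dense by
  transitivity; by Baire's theorem some point lies in all of these sets.\<close>

lemma transitive_on_dense_orbit:
  assumes X: "compact X" "X \<noteq> {}" and h: "homeomorphism X X f (inv_into X f)"
    and trans: "transitive_on X f"
  shows "\<exists>x\<in>X. X \<subseteq> closure (range (\<lambda>n. int_iterate X f n x))"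
proof -
  have "\<exists>k. finite k \<and> k \<subseteq> X \<and> X \<subseteq> (\<Union>c\<in>k. ball c (1 / real (Suc i)))" for i
    using seq_compact_imp_totally_bounded[of X] X(1) by (simp add: compact_imp_seq_compact)
  then obtain k where k: "\<And>i. finite (k i)" "\<And>i. k i \<subseteq> X"
    "\<And>i. X \<subseteq> (\<Union>c\<in>k i. ball c (1 / real (Suc i)))" by metis
  define G where "G i c = (\<Union>m. X \<inter> int_iterate X f m -` ball c (1 / real (Suc i)))" for i c
  define \<G> where "\<G> = (\<Union>i. G i ` k i)"
  have "top_of_set X closure_of \<Inter>\<G> = topspace (top_of_set X)"
  proof (rule Baire_category)
    have "compact_space (top_of_set X)" using X by (simp add: compact_space_subtopology)
    then show "completely_metrizable_space (top_of_set X) \<or>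
        locally_compact_space (top_of_set X) \<and> regular_space (top_of_set X)"
      by (simp add: compact_imp_locally_compact_space metrizable_imp_regular_space
          metrizable_space_euclidean metrizable_space_subtopology)
    show "countable \<G>" unfolding \<G>_def using k(1) by (auto intro: countable_finite)
    fix T assume "T \<in> \<G>"
    then obtain i c where T: "T = G i c" and c: "c \<in> X" using k(2) by (auto simp: \<G>_def)
    have "openin (top_of_set X) T"
      unfolding T G_def using h
      by (intro openin_Union ballI)
         (auto simp: homeomorphism_def intro!: continuous_openin_preimage_gen continuous_on_int_iterate)
    moreover have "T \<inter> U \<noteq> {}" if U: "openin (top_of_set X) U" "U \<noteq> {}" for U
    proof -
      have "openin (top_of_set X) (X \<inter> ball c (1 / real (Suc i)))" by (simp add: openin_open_Int)
      moreover have "X \<inter> ball c (1 / real (Suc i)) \<noteq> {}" using c by auto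
      ultimately obtain m where "int_iterate X f m ` U \<inter> (X \<inter> ball c (1 / real (Suc i))) \<noteq> {}"
        using trans U unfolding transitive_on_def by blast
      moreover have "U \<subseteq> X" using U openin_imp_subset by blast
      ultimately show ?thesis unfolding T G_def by blast
    qed
    ultimately show "openin (top_of_set X) T \<and> top_of_set X closure_of T = topspace (top_of_set X)"
      unfolding dense_intersects_open by blast
  qed
  then have "X \<inter> \<Inter>\<G> \<noteq> {}"
    using X(2) by (metis closure_of_empty closure_of_restrict topspace_euclidean_subtopology)
  then obtain x where x: "x \<in> X" "\<And>T. T \<in> \<G> \<Longrightarrow> x \<in> T" by blast
  have "y \<in> closure (range (\<lambda>n. int_iterate X f n x))" if y: "y \<in> X" for y
    unfolding closure_approachable
  proof (intro allI impI)
    fix e :: real assume "e > 0"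
    then obtain i where i: "1 / real (Suc i) < e / 2"
      by (metis half_gt_zero inverse_eq_divide reals_Archimedean)
    obtain c where c: "c \<in> k i" "dist c y < 1 / real (Suc i)" using k(3) y by fastforce
    then have "x \<in> G i c" using x(2) by (auto simp: \<G>_def)
    then obtain m where "dist c (int_iterate X f m x) < 1 / real (Suc i)" by (auto simp: G_def)
    then have "dist (int_iterate X f m x) y < e"
      using dist_triangle3[of "int_iterate X f m x" y c] c(2) i by linarith
    then show "\<exists>z\<in>range (\<lambda>n. int_iterate X f n x). dist z y < e" by blast
  qed
  then show ?thesis using x(1) by blast
qed

lemma minimal_subset_subset: "minimal_subset X f A \<Longrightarrow> A \<subseteq> X"
  using closedin_subset[of "top_of_set X" A] by (simp add: minimal_subset_def)

text \<open>Injectivity makes the intersection invariant. If nonempty, it cannot be proper in either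
  minimal set, so it equals both.\<close>

lemma minimal_subset_disjoint:
  assumes "inj_on f X" "minimal_subset X f A" "minimal_subset X f B" "A \<noteq> B"
  shows "A \<inter> B = {}"
proof (rule ccontr)
  assume "A \<inter> B \<noteq> {}"
  moreover have "closedin (top_of_set X) (A \<inter> B)"
    using assms by (simp add: minimal_subset_def closedin_Int)
  moreover have "f ` (A \<inter> B) = A \<inter> B"
    using inj_on_image_Int[OF assms(1)] assms minimal_subset_subset
    by (metis minimal_subset_def)
  ultimately have "\<not> A \<inter> B \<subset> C" if "minimal_subset X f C" for C
    using that unfolding minimal_subset_def by metis
  then have "\<not> A \<inter> B \<subset> A" "\<not> A \<inter> B \<subset> B" using assms(2,3) by blast+
  then show False using assms(4) by blast
qed

theorem theorem3p5:
  fixes X :: "'a::metric_space set" and f :: "'a \<Rightarrow> 'a" and N :: nat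
  assumes "compact X"
    and "1 \<le> N"
    and "\<exists>g. homeomorphism X X f g"
    and "transitive_on X f"
    and "N_distal X f N"
  shows "finite {A. minimal_subset X f A \<and> A \<subset> X} \<and>
         card {A. minimal_subset X f A \<and> A \<subset> X} \<le> N - 1"
proof (cases "X = {}")
  \<comment> \<open>The empty space has no proper subsets; it is split off because a dense orbit
    needs a point.\<close>
  case True
  then show ?thesis by simp
next
  case False
  let ?M = "{A. minimal_subset X f A \<and> A \<subset> X}"
  have h: "homeomorphism X X f (inv_into X f)" using assms(3) homeomorphism_inv_into by blast
  have inj: "inj_on f X" using homeomorphism_apply1[OF h] by (rule inj_on_inverseI)
  obtain x where x: "x \<in> X" and dense: "X \<subseteq> closure (range (\<lambda>n. int_iterate X f n x))"
    using transitive_on_dense_orbit[OF assms(1) False h assms(4)] by blast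
  have "\<exists>y\<in>A. y \<in> proximal_cell X f x - {x}" if A: "A \<in> ?M" for A
  proof -
    have AX: "A \<subset> X" "A \<noteq> {}" "f ` A = A" "closed A"
      using A assms(1) closedin_closed_trans compact_imp_closed by (auto simp: minimal_subset_def)
    have inv: "inv_into X f ` A \<subseteq> A"
      using AX inj by (metis inv_into_image_cancel order.refl psubset_imp_subset)
    have "x \<notin> A"
    proof
      assume "x \<in> A"
      then have "range (\<lambda>n. int_iterate X f n x) \<subseteq> A"
        \<comment> \<open>The statement about pairs is used on the diagonal, with the invariant set
          \<open>A \<times> A\<close>.\<close>
        using map_prod_int_iterate_invariant[of f "A \<times> A" X x x] AX inv by auto
      then have "X \<subseteq> A" using dense AX(4) by (meson closure_minimal order_trans)
      then show False using AX by blast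
    qed
    moreover have "\<exists>y\<in>A. y \<in> proximal_cell X f x"
      using AX inv dense by (intro auslander_ellis[OF assms(1) h x]) auto
    ultimately show ?thesis by blast
  qed
  then obtain y where y: "\<And>A. A \<in> ?M \<Longrightarrow> y A \<in> A \<and> y A \<in> proximal_cell X f x - {x}" by metis
  have "inj_on y ?M"
  proof (rule inj_onI)
    fix A B assume AB: "A \<in> ?M" "B \<in> ?M" "y A = y B"
    then have "A \<inter> B \<noteq> {}" using y by (metis IntI empty_iff)
    then show "A = B" using minimal_subset_disjoint[OF inj] AB by blast
  qed
  moreover have "y ` ?M \<subseteq> proximal_cell X f x - {x}" using y by blast
  moreover have "finite (proximal_cell X f x)" "card (proximal_cell X f x) \<le> N"
    using assms(5) x by (auto simp: N_distal_def)
  \<comment> \<open>Since \<open>x\<close> itself occupies one place in its cell, at most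
    \<open>N - 1\<close> places remain for the chosen points.\<close>
  moreover have "x \<in> proximal_cell X f x" using x by (intro proximal_cellI) auto
  ultimately show ?thesis
    using inj_on_finite[of y ?M] card_inj_on_le[of y ?M "proximal_cell X f x - {x}"] by auto
qed

end
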